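(* Let $G$ be a compact abelian group and let $f$ be a continuous positive definite function on $G$. Then $f$ is strictly positive definite if and only if the support $\{\gamma \in \widehat{G} : \widehat{f}(\gamma) \neq 0\}$ of its Fourier transform is a strictly positive definite subset of $\widehat{G}$.
   Context: A function $f: G \to \mathbb{C}$ is positive definite if for all $n$, all $x_1,\dots,x_n \in G$ and all $c_1,\dots,c_n \in \mathbb{C}\setminus\{0\}$ one has $\sum_{i,j=1}^n c_i \overline{c_j} f(x_j^{-1}x_i) \ge 0$; it is strictly positive definite if moreover this sum is strictly positive whenever $x_1,\dots,x_n$ are pairwise distinct. A trigonometric polynomial on $\widehat{G}$ is a function of the form $\gamma \mapsto \sum_{i=1}^n c_i \gamma(x_i)$ with $x_i \in G$, $c_i \in \mathbb{C}$. A subset $K \subset \widehat{G}$ is strictly positive definite if the only trigonometric polynomial on $\widehat{G}$ vanishing at every point of $K$ is the identically zero function. *)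

theory Defs
  imports "HOL-Probability.Probability" "HOL-Library.Complex_Order"
begin

text \<open>The group G is a type 'a with an abelian group structure (written additively,
  so x_j^{-1} x_i becomes x_i - x_j) and a Hausdorff topology.\<close>

definition compact_abelian_group :: "'a::{ab_group_add,t2_space} itself \<Rightarrow> bool" where
  "compact_abelian_group _ \<longleftrightarrow>
     continuous_on UNIV (\<lambda>p::'a \<times> 'a. fst p + snd p) \<and>
     continuous_on UNIV (uminus :: 'a \<Rightarrow> 'a) \<and>
     compact (UNIV :: 'a set)"

definition haar_measure :: "'a::{ab_group_add,topological_space} measure \<Rightarrow> bool" where
  "haar_measure \<mu> \<longleftrightarrow> prob_space \<mu> \<and> sets \<mu> = sets borel \<and>
     (\<forall>a A. A \<in> sets borel \<longrightarrow> emeasure \<mu> ((\<lambda>x. a + x) -` A) = emeasure \<mu> A)"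

definition dual_group :: "('a::{ab_group_add,topological_space} \<Rightarrow> complex) set" where
  "dual_group = {\<gamma>. continuous_on UNIV \<gamma> \<and> (\<forall>x. norm (\<gamma> x) = 1) \<and>
                      (\<forall>x y. \<gamma> (x + y) = \<gamma> x * \<gamma> y)}"

definition positive_definite :: "('a::ab_group_add \<Rightarrow> complex) \<Rightarrow> bool" where
  "positive_definite f \<longleftrightarrow>
     (\<forall>(n::nat) (x::nat \<Rightarrow> 'a) (c::nat \<Rightarrow> complex). n \<ge> 1 \<longrightarrow> (\<forall>i<n. c i \<noteq> 0) \<longrightarrow>
        (\<Sum>i<n. \<Sum>j<n. c i * cnj (c j) * f (x i - x j)) \<ge> 0)"

definition strictly_positive_definite :: "('a::ab_group_add \<Rightarrow> complex) \<Rightarrow> bool" where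
  "strictly_positive_definite f \<longleftrightarrow> positive_definite f \<and>
     (\<forall>(n::nat) (x::nat \<Rightarrow> 'a) (c::nat \<Rightarrow> complex). n \<ge> 1 \<longrightarrow> (\<forall>i<n. c i \<noteq> 0) \<longrightarrow>
        inj_on x {..<n} \<longrightarrow>
        (\<Sum>i<n. \<Sum>j<n. c i * cnj (c j) * f (x i - x j)) > 0)"

definition trig_poly :: "nat \<Rightarrow> (nat \<Rightarrow> 'a) \<Rightarrow> (nat \<Rightarrow> complex) \<Rightarrow> ('a \<Rightarrow> complex) \<Rightarrow> complex" where
  "trig_poly n x c = (\<lambda>\<gamma>. \<Sum>i<n. c i * \<gamma> (x i))"

definition spd_subset :: "('a::{ab_group_add,topological_space} \<Rightarrow> complex) set \<Rightarrow> bool" where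
  "spd_subset K \<longleftrightarrow>
     (\<forall>n x c. (\<forall>\<gamma>\<in>K. trig_poly n x c \<gamma> = 0) \<longrightarrow> (\<forall>\<gamma>\<in>dual_group. trig_poly n x c \<gamma> = 0))"

definition fourier_transform :: "'a measure \<Rightarrow> ('a \<Rightarrow> complex) \<Rightarrow> ('a \<Rightarrow> complex) \<Rightarrow> complex" where
  "fourier_transform \<mu> f \<gamma> = (\<integral>x. f x * cnj (\<gamma> x) \<partial>\<mu>)"

definition fourier_support :: "'a::{ab_group_add,topological_space} measure \<Rightarrow> ('a \<Rightarrow> complex) \<Rightarrow> ('a \<Rightarrow> complex) set" where
  "fourier_support \<mu> f = {\<gamma>\<in>dual_group. fourier_transform \<mu> f \<gamma> \<noteq> 0}"

end

theory Submission
  imports Defs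
begin

text \<open>Given coefficients \<open>c i\<close> and points \<open>a i\<close>, put
  \<open>g x = (\<Sum>i j. c i * cnj (c j) * f (x + a i - a j))\<close>. Its value at 0 is the quadratic form of \<open>f\<close>, and its
  Fourier transform is that of \<open>f\<close> times the squared modulus of the trigonometric polynomial
  \<open>p \<gamma> = (\<Sum>i. c i * \<gamma> (a i))\<close>. Since \<open>g\<close> is positive definite, it vanishes identically as soon as
  \<open>g 0 = 0\<close>; hence the quadratic form is 0 iff \<open>p\<close> vanishes on the support of the transform of \<open>f\<close>.
  Both this and the linear independence of the evaluations at distinct points rest on the
  injectivity of the Fourier transform on continuous functions.

  Injectivity amounts to producing, for continuous \<open>k \<noteq> 0\<close>, a character at which the transform of
  \<open>k\<close> does not vanish. The normalised convolution powers of \<open>h = k * adj k\<close> converge to a continuous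
  idempotent; below any idempotent there is a minimal one, and the translates of a minimal
  idempotent are multiples of it, so it is a multiple of a character.\<close>

section \<open>Integration of continuous functions on the group\<close>

locale compact_abelian_haar =
  fixes \<mu> :: "'a::{ab_group_add,t2_space} measure"
  assumes group: "compact_abelian_group TYPE('a)"
    and haar: "haar_measure \<mu>"
begin

sublocale prob_space \<mu>
  using haar by (simp add: haar_measure_def)

lemma sets_haar [measurable_cong]: "sets \<mu> = sets borel"
  using haar by (simp add: haar_measure_def)

lemma space_haar [simp]: "space \<mu> = UNIV"
  using sets_eq_imp_space_eq[OF sets_haar] by simp

lemma prob_UNIV [simp]: "prob UNIV = 1"
  using prob_space by simp

lemma compact_group: "compact (UNIV :: 'a set)"
  using group by (simp add: compact_abelian_group_def)

lemma continuous_on_group_add [continuous_intros]: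
  fixes g h :: "'b::topological_space \<Rightarrow> 'a"
  assumes "continuous_on S g" "continuous_on S h"
  shows "continuous_on S (\<lambda>x. g x + h x)"
proof -
  have "continuous_on UNIV (\<lambda>p::'a \<times> 'a. fst p + snd p)"
    using group by (simp add: compact_abelian_group_def)
  from continuous_on_compose2[OF this continuous_on_Pair[OF assms]] show ?thesis by simp
qed

lemma continuous_on_group_uminus [continuous_intros]:
  fixes g :: "'b::topological_space \<Rightarrow> 'a"
  assumes "continuous_on S g"
  shows "continuous_on S (\<lambda>x. - g x)"
proof -
  have "continuous_on UNIV (uminus :: 'a \<Rightarrow> 'a)"
    using group by (simp add: compact_abelian_group_def)
  from continuous_on_compose2[OF this assms] show ?thesis by simp
qed

lemma continuous_on_group_diff [continuous_intros]:
  fixes g h :: "'b::topological_space \<Rightarrow> 'a"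
  assumes "continuous_on S g" "continuous_on S h"
  shows "continuous_on S (\<lambda>x. g x - h x)"
  using continuous_on_group_add[OF assms(1) continuous_on_group_uminus[OF assms(2)]] by simp

lemma continuous_on_UNIV_compose:
  fixes f :: "'b::topological_space \<Rightarrow> 'c::topological_space"
  assumes "continuous_on UNIV f" "continuous_on S g"
  shows "continuous_on S (\<lambda>x. f (g x))"
  using continuous_on_compose2[OF assms] by simp

lemma bounded_continuous:
  fixes f :: "'a \<Rightarrow> 'b::real_normed_vector"
  assumes "continuous_on UNIV f"
  obtains B where "\<And>x. norm (f x) \<le> B"
proof -
  have "\<exists>B. \<forall>x. norm (f x) \<le> B"
    using compact_imp_bounded[OF compact_continuous_image[OF assms compact_group]]
    by (auto simp: bounded_iff)
  then show ?thesis using that by metis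
qed

lemma measurable_haar_continuous:
  fixes f :: "'a \<Rightarrow> 'b::topological_space"
  assumes "continuous_on UNIV f"
  shows "f \<in> borel_measurable \<mu>"
  using borel_measurable_continuous_onI[OF assms] by (simp cong: measurable_cong_sets add: sets_haar)

lemma integrable_haar_continuous:
  fixes f :: "'a \<Rightarrow> 'b::{banach, second_countable_topology}"
  assumes "continuous_on UNIV f"
  shows "integrable \<mu> f"
proof -
  obtain B where "\<And>x. norm (f x) \<le> B" using bounded_continuous[OF assms] by blast
  then show ?thesis
    by (intro integrable_const_bound[where B=B] measurable_haar_continuous assms) auto
qed

section \<open>Translation invariance of the integral\<close>

lemma measurable_translation: "(\<lambda>x. a + x) \<in> measurable \<mu> \<mu>"
proof -
  have "continuous_on UNIV (\<lambda>x. a + x)" by (intro continuous_intros)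
  from measurable_haar_continuous[OF this] show ?thesis
    using measurable_cong_sets[OF refl sets_haar] by blast
qed

lemma distr_translation: "distr \<mu> \<mu> (\<lambda>x. a + x) = \<mu>"
proof (rule measure_eqI)
  fix A assume "A \<in> sets (distr \<mu> \<mu> (\<lambda>x. a + x))"
  then show "emeasure (distr \<mu> \<mu> (\<lambda>x. a + x)) A = emeasure \<mu> A"
    using haar measurable_translation by (simp add: emeasure_distr haar_measure_def sets_haar)
qed simp

lemma integral_translation:
  fixes f :: "'a \<Rightarrow> 'b::{banach, second_countable_topology}"
  assumes "continuous_on UNIV f"
  shows "(\<integral>x. f (a + x) \<partial>\<mu>) = (\<integral>x. f x \<partial>\<mu>)"
proof -
  show ?thesis
    using integral_distr[OF measurable_translation measurable_haar_continuous[OF assms]] by (simp add: distr_translation)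
qed

lemma norm_integral_diff_le:
  fixes f g :: "'a \<Rightarrow> 'b::{banach, second_countable_topology}"
  assumes "integrable \<mu> f" "integrable \<mu> g" "\<And>x. norm (f x - g x) \<le> e"
  shows "norm ((\<integral>x. f x \<partial>\<mu>) - (\<integral>x. g x \<partial>\<mu>)) \<le> e"
proof -
  have "norm (\<integral>x. f x - g x \<partial>\<mu>) \<le> (\<integral>x. norm (f x - g x) \<partial>\<mu>)"
    by (rule integral_norm_bound)
  also have "\<dots> \<le> (\<integral>x. e \<partial>\<mu>)"
    by (intro integral_mono) (use assms in auto)
  finally show ?thesis using assms by simp
qed

section \<open>Continuity in a parameter and exchange of the order of integration\<close>

lemma continuous_on_section:
  fixes F :: "'a \<Rightarrow> 'a \<Rightarrow> 'b::topological_space"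
  assumes "continuous_on UNIV (\<lambda>p. F (fst p) (snd p))"
  shows "continuous_on UNIV (\<lambda>y. F x y)" "continuous_on UNIV (\<lambda>x. F x y)"
proof -
  have "continuous_on UNIV (\<lambda>y::'a. (x, y))" "continuous_on UNIV (\<lambda>x::'a. (x, y))"
    by (intro continuous_intros)+
  from this[THEN continuous_on_UNIV_compose[OF assms]]
  show "continuous_on UNIV (\<lambda>y. F x y)" "continuous_on UNIV (\<lambda>x. F x y)"
    by simp_all
qed

text \<open>A form of the tube lemma: compactness of the second factor makes continuity in
  \<open>x\<close> uniform in \<open>y\<close>.\<close>

lemma uniform_section_neighbourhood:
  fixes F :: "'a \<Rightarrow> 'a \<Rightarrow> 'b::real_normed_vector"
  assumes "continuous_on UNIV (\<lambda>p. F (fst p) (snd p))" "e > 0"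
  shows "\<exists>U. open U \<and> x \<in> U \<and> (\<forall>x'\<in>U. \<forall>y. norm (F x' y - F x y) \<le> e)"
proof -
  have "continuous_on (UNIV \<times> UNIV) (\<lambda>p. F (fst p) (snd p))"
    unfolding UNIV_Times_UNIV by (rule assms(1))
  from continuous_on_prod_compactE[OF this compact_group UNIV_I assms(2)]
  obtain U where "x \<in> U" "open U"
      "\<forall>x'\<in>U \<inter> UNIV. \<forall>y\<in>UNIV. dist (F (fst (x', y)) (snd (x', y))) (F (fst (x, y)) (snd (x, y))) \<le> e"
    by blast
  then show ?thesis by (intro exI[of _ U]) (simp add: dist_norm)
qed

text \<open>As the total mass is 1, uniformly close sections have equally close integrals.\<close>

lemma continuous_on_integral_section:
  fixes F :: "'a \<Rightarrow> 'a \<Rightarrow> 'b::{banach, second_countable_topology}"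
  assumes "continuous_on UNIV (\<lambda>p. F (fst p) (snd p))"
  shows "continuous_on UNIV (\<lambda>x. \<integral>y. F x y \<partial>\<mu>)"
proof -
  have "((\<lambda>x. \<integral>y. F x y \<partial>\<mu>) \<longlongrightarrow> (\<integral>y. F x y \<partial>\<mu>)) (at x)" for x
  proof (rule tendstoI)
    fix e :: real assume "e > 0"
    then have "e / 2 > 0" by simp
    from uniform_section_neighbourhood[OF assms this, of x]
    obtain U where U: "open U" "x \<in> U" "\<And>x' y. x' \<in> U \<Longrightarrow> norm (F x' y - F x y) \<le> e / 2"
      by blast
    have "norm ((\<integral>y. F x' y \<partial>\<mu>) - (\<integral>y. F x y \<partial>\<mu>)) \<le> e / 2" if "x' \<in> U" for x'
      by (intro norm_integral_diff_le integrable_haar_continuous continuous_on_section assms U that)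
    then show "\<forall>\<^sub>F x' in at x. dist (\<integral>y. F x' y \<partial>\<mu>) (\<integral>y. F x y \<partial>\<mu>) < e"
      using U \<open>e > 0\<close> unfolding eventually_at_topological dist_norm
      by (intro exI[of _ U]) force
  qed
  then show ?thesis by (simp add: continuous_on_def)
qed

text \<open>In the absence of second countability the Borel sets of the product need not be generated by
  rectangles, so the product measure is of no use here. Instead \<open>F\<close> is approximated uniformly by
  finite sums of functions \<open>indicator A x * F d y\<close>.\<close>

lemma fubini_continuous:
  fixes F :: "'a \<Rightarrow> 'a \<Rightarrow> complex"
  assumes F: "continuous_on UNIV (\<lambda>p. F (fst p) (snd p))"
  shows "(\<integral>x. (\<integral>y. F x y \<partial>\<mu>) \<partial>\<mu>) = (\<integral>y. (\<integral>x. F x y \<partial>\<mu>) \<partial>\<mu>)" (is "?L = ?R")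
proof -
  have F': "continuous_on UNIV (\<lambda>p. F (snd p) (fst p))"
    using continuous_on_UNIV_compose[OF F, of UNIV "\<lambda>p. (snd p, fst p)"]
    by (simp add: continuous_on_Pair continuous_on_fst continuous_on_snd)
  have "norm (?L - ?R) \<le> e + e" if e: "e > 0" for e
  proof -
    obtain U where U: "\<And>x. open (U x)" "\<And>x. x \<in> U x"
        "\<And>x x' y. x' \<in> U x \<Longrightarrow> norm (F x' y - F x y) \<le> e"
      using uniform_section_neighbourhood[OF F e] by metis
    have "UNIV \<subseteq> (\<Union>a\<in>UNIV. U a)" using U(2) by blast
    from compactE_image[OF compact_group U(1) this]
    obtain D where D: "finite D" "UNIV \<subseteq> (\<Union>d\<in>D. U d)"
      by metis
    obtain n and d :: "nat \<Rightarrow> 'a" where d: "D = d ` {i. i < n}"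
      using finite_imp_nat_seg_image_inj_on[OF D(1)] by metis
    \<comment> \<open>The finite cover is made disjoint, so exactly one indicator in
      \<open>G\<close> below is 1 at each \<open>x\<close>. Integrals of \<open>G\<close> become
      finite sums, and its two iterated integrals agree.\<close>
    define A where "A i = U (d i) - (\<Union>j<i. U (d j))" for i
    have A [measurable]: "A i \<in> sets \<mu>" for i
      unfolding A_def sets_haar using U by auto
    have disj: "i = j" if "x \<in> A i" "x \<in> A j" for i j x
      using that unfolding A_def by (metis Diff_iff UN_I lessThan_iff linorder_neqE_nat)
    have cover: "\<exists>i<n. x \<in> A i" for x
    proof -
      have "\<exists>i. i < n \<and> x \<in> U (d i)" using D(2) d by auto
      then have "\<exists>i. (i < n \<and> x \<in> U (d i)) \<and> (\<forall>j<i. \<not> (j < n \<and> x \<in> U (d j)))"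
        by (rule exists_least_iff[THEN iffD1])
      then obtain i where i: "i < n" "x \<in> U (d i)" "\<And>j. j < i \<Longrightarrow> j < n \<Longrightarrow> x \<notin> U (d j)"
        by blast
      then have "x \<in> A i" unfolding A_def by auto
      then show ?thesis using i(1) by blast
    qed
    define G where "G x y = (\<Sum>i<n. indicator (A i) x * F (d i) y)" for x y
    have close: "norm (F x y - G x y) \<le> e" for x y
    proof -
      obtain i where i: "i < n" "x \<in> A i" using cover by blast
      have "G x y = (\<Sum>j<n. if j = i then F (d i) y else 0)"
        unfolding G_def by (rule sum.cong) (use i disj in \<open>auto simp: indicator_def\<close>)
      then have "G x y = F (d i) y" using i by simp
      then show ?thesis using U(3)[of x "d i" y] i by (simp add: A_def)
    qed
    have int_ind: "integrable \<mu> (\<lambda>x. indicator (A i) x * c)" for i and c :: complex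
      by (intro integrable_mult_left integrable_const_bound[where B=1]) (auto simp: indicator_def)
    have int_ind_eq: "(\<integral>x. indicator (A i) x * c \<partial>\<mu>) = complex_of_real (measure \<mu> (A i)) * c" for i c
    proof -
      have "(\<integral>x. indicator (A i) x * c \<partial>\<mu>) = (\<integral>x. indicator (A i) x *\<^sub>R c \<partial>\<mu>)"
        by (intro Bochner_Integration.integral_cong) (auto simp: indicator_def)
      also have "\<dots> = measure \<mu> (A i) *\<^sub>R c"
        by (subst integral_scaleR_left) (auto intro!: integrable_const_bound[where B=1] simp: indicator_def)
      finally show ?thesis by (simp add: scaleR_conv_of_real)
    qed
    note F_int = integrable_haar_continuous[OF continuous_on_section(1)[OF F]]
    have Gy_int: "(\<integral>y. G x y \<partial>\<mu>) = (\<Sum>i<n. indicator (A i) x * (\<integral>y. F (d i) y \<partial>\<mu>))" for x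
      unfolding G_def by (subst Bochner_Integration.integral_sum) (auto intro!: F_int)
    have Gx_int: "(\<integral>x. G x y \<partial>\<mu>) = (\<Sum>i<n. complex_of_real (measure \<mu> (A i)) * F (d i) y)" for y
      unfolding G_def by (subst Bochner_Integration.integral_sum[OF int_ind]) (simp only: int_ind_eq)
    have L: "(\<integral>x. (\<integral>y. G x y \<partial>\<mu>) \<partial>\<mu>) = (\<Sum>i<n. complex_of_real (measure \<mu> (A i)) * (\<integral>y. F (d i) y \<partial>\<mu>))"
      unfolding Gy_int by (subst Bochner_Integration.integral_sum[OF int_ind]) (simp only: int_ind_eq)
    have R: "(\<integral>y. (\<integral>x. G x y \<partial>\<mu>) \<partial>\<mu>) = (\<Sum>i<n. complex_of_real (measure \<mu> (A i)) * (\<integral>y. F (d i) y \<partial>\<mu>))"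
      unfolding Gx_int using F_int by simp
    have Gx: "integrable \<mu> (\<lambda>x. G x y)" for y
      unfolding G_def by (intro Bochner_Integration.integrable_sum int_ind)
    have Gy: "integrable \<mu> (\<lambda>y. G x y)" for x
      unfolding G_def using F_int by auto
    have GL: "integrable \<mu> (\<lambda>x. \<integral>y. G x y \<partial>\<mu>)"
      unfolding Gy_int by (intro Bochner_Integration.integrable_sum int_ind)
    have GR: "integrable \<mu> (\<lambda>y. \<integral>x. G x y \<partial>\<mu>)"
      unfolding Gx_int using F_int by auto
    have a: "norm (?L - (\<integral>x. (\<integral>y. G x y \<partial>\<mu>) \<partial>\<mu>)) \<le> e"
      by (intro norm_integral_diff_le integrable_haar_continuous continuous_on_integral_section
          continuous_on_section F GL Gy close)
    have "norm (?R - (\<integral>y. (\<integral>x. G x y \<partial>\<mu>) \<partial>\<mu>)) \<le> e"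
      by (intro norm_integral_diff_le integrable_haar_continuous continuous_on_integral_section
          continuous_on_section F F' GR Gx close)
    then have b: "norm ((\<integral>y. (\<integral>x. G x y \<partial>\<mu>) \<partial>\<mu>) - ?R) \<le> e"
      by (subst norm_minus_commute)
    show ?thesis
      by (rule norm_diff_triangle_le[OF a[unfolded L] b[unfolded R]])
  qed
  note bound = this
  have "norm (?L - ?R) \<le> 0"
  proof (rule field_le_epsilon)
    fix e :: real assume "e > 0"
    then have "norm (?L - ?R) \<le> e / 2 + e / 2" by (intro bound half_gt_zero)
    then show "norm (?L - ?R) \<le> 0 + e" by (simp only: field_sum_of_halves add_0)
  qed
  then show ?thesis by (simp only: norm_le_zero_iff right_minus_eq)
qed

text \<open>Integrate \<open>f (x - y)\<close> over both variables: the inner integral over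
  \<open>y\<close> is the reflected one for every \<open>x\<close>, that over \<open>x\<close> the
  original one for every \<open>y\<close>. Exchanging the order equates them, without appeal to
  uniqueness of Haar measure.\<close>

lemma integral_uminus:
  fixes f :: "'a \<Rightarrow> complex"
  assumes f: "continuous_on UNIV f"
  shows "(\<integral>x. f (- x) \<partial>\<mu>) = (\<integral>x. f x \<partial>\<mu>)"
proof -
  have c: "continuous_on UNIV (\<lambda>p. f (fst p - snd p))"
    by (intro continuous_on_UNIV_compose[OF f] continuous_intros)
  have 1: "(\<integral>y. f (x - y) \<partial>\<mu>) = (\<integral>y. f (- y) \<partial>\<mu>)" for x
    using integral_translation[OF continuous_on_UNIV_compose[OF f], of "\<lambda>y. x - y" x]
    by (simp add: continuous_intros)
  have 2: "(\<integral>x. f (x - y) \<partial>\<mu>) = (\<integral>x. f x \<partial>\<mu>)" for y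
    using integral_translation[OF f, of "- y"] by simp
  from fubini_continuous[OF c] show ?thesis by (simp add: 1 2)
qed

lemma integral_reflection:
  fixes f :: "'a \<Rightarrow> complex"
  assumes f: "continuous_on UNIV f"
  shows "(\<integral>y. f (x - y) \<partial>\<mu>) = (\<integral>y. f y \<partial>\<mu>)"
proof -
  have "continuous_on UNIV (\<lambda>y. f (x + y))"
    by (intro continuous_on_UNIV_compose[OF f] continuous_intros)
  from integral_uminus[OF this] show ?thesis by (simp add: integral_translation[OF f])
qed

text \<open>Finitely many translates of \<open>U\<close> cover the compact group; if
  \<open>U\<close> were null, the whole group would be.\<close>

lemma emeasure_open_pos:
  assumes "open U" "U \<noteq> {}"
  shows "emeasure \<mu> U > 0"
proof (rule ccontr)
  assume "\<not> emeasure \<mu> U > 0"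
  then have null: "emeasure \<mu> U = 0" by simp
  obtain u where u: "u \<in> U" using assms by auto
  define V where "V a = (\<lambda>x. a + x) -` U" for a
  have V: "open (V a)" "emeasure \<mu> (V a) = 0" for a
  proof -
    show "open (V a)" unfolding V_def
      by (rule open_vimage[OF assms(1)]) (intro continuous_intros)
    show "emeasure \<mu> (V a) = 0" unfolding V_def
      using haar assms(1) null by (simp add: haar_measure_def)
  qed
  have "x \<in> V (u - x)" for x using u by (simp add: V_def)
  then have "UNIV \<subseteq> (\<Union>a\<in>UNIV. V a)" by blast
  from compactE_image[OF compact_group V(1) this]
  obtain D where D: "finite D" "UNIV \<subseteq> (\<Union>a\<in>D. V a)"
    by metis
  have "emeasure \<mu> UNIV \<le> emeasure \<mu> (\<Union>a\<in>D. V a)"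
    using D V by (intro emeasure_mono) (auto simp: sets_haar)
  also have "\<dots> \<le> (\<Sum>a\<in>D. emeasure \<mu> (V a))"
    using D V by (intro emeasure_subadditive_finite) (auto simp: sets_haar)
  also have "\<dots> = 0" using V by simp
  finally show False using emeasure_space_1 by simp
qed

lemma integral_nonneg_continuous_eq_0:
  fixes f :: "'a \<Rightarrow> real"
  assumes f: "continuous_on UNIV f" "\<And>x. f x \<ge> 0" and 0: "(\<integral>x. f x \<partial>\<mu>) = 0"
  shows "f x = 0"
proof (rule ccontr)
  assume "f x \<noteq> 0"
  define U where "U = f -` {0<..}"
  have U: "open U" unfolding U_def by (rule open_vimage[OF open_greaterThan f(1)])
  have "AE x in \<mu>. f x = 0"
    using integral_nonneg_eq_0_iff_AE[OF integrable_haar_continuous[OF f(1)]] f(2) 0 by simp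
  then have "AE x in \<mu>. x \<notin> U" by (rule AE_mp) (auto simp: U_def)
  then have "emeasure \<mu> U = 0"
    using U by (subst (asm) AE_iff_measurable[of U]) (auto simp: sets_haar)
  moreover have "x \<in> U" using \<open>f x \<noteq> 0\<close> f(2)[of x] by (simp add: U_def order.not_eq_order_implies_strict)
  ultimately show False using emeasure_open_pos[OF U] by auto
qed

end

section \<open>Convolution\<close>

text \<open>The involution of the convolution algebra. On the Fourier side it is complex
  conjugation, so self-adjoint functions have real transforms.\<close>

definition adj :: "('a::ab_group_add \<Rightarrow> complex) \<Rightarrow> 'a \<Rightarrow> complex" where
  "adj f = (\<lambda>x. cnj (f (- x)))"

lemma adj_adj [simp]: "adj (adj f) = f"
  by (simp add: adj_def)

lemma dual_group_add: "\<gamma> \<in> dual_group \<Longrightarrow> \<gamma> (x + y) = \<gamma> x * \<gamma> y"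
  by (simp add: dual_group_def)

lemma dual_group_uminus:
  assumes "\<gamma> \<in> dual_group"
  shows "\<gamma> (- y) = cnj (\<gamma> y)"
proof -
  have n: "norm (\<gamma> a) = 1" for a using assms by (simp add: dual_group_def)
  have "\<gamma> 0 = 1" using dual_group_add[OF assms, of 0 0] n[of 0] by auto
  then have "\<gamma> (- y) * \<gamma> y = 1" using dual_group_add[OF assms, of "- y" y] by simp
  moreover have "cnj (\<gamma> y) * \<gamma> y = 1"
    using complex_norm_square[of "\<gamma> y"] n[of y] by (simp add: mult.commute)
  ultimately show ?thesis by (metis mult_cancel_right mult_zero_right zero_neq_one)
qed

context compact_abelian_haar
begin

definition conv :: "('a \<Rightarrow> complex) \<Rightarrow> ('a \<Rightarrow> complex) \<Rightarrow> 'a \<Rightarrow> complex" (infixl \<open>\<odot>\<close> 70) where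
  "f \<odot> g = (\<lambda>x. \<integral>y. f y * g (x - y) \<partial>\<mu>)"

definition norm2sq :: "('a \<Rightarrow> complex) \<Rightarrow> real" where
  "norm2sq f = (\<integral>x. (norm (f x))\<^sup>2 \<partial>\<mu>)"

lemma continuous_on_reflect:
  fixes f :: "'a \<Rightarrow> 'b::topological_space"
  assumes "continuous_on UNIV f"
  shows "continuous_on UNIV (\<lambda>y. f (x - y))"
  by (intro continuous_on_UNIV_compose[OF assms] continuous_intros)

lemma continuous_on_translate:
  fixes f :: "'a \<Rightarrow> 'b::topological_space"
  assumes "continuous_on UNIV f"
  shows "continuous_on UNIV (\<lambda>y. f (y + a))"
  by (intro continuous_on_UNIV_compose[OF assms] continuous_intros)

lemma continuous_on_adj [simp]:
  fixes f :: "'a \<Rightarrow> complex"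
  assumes "continuous_on UNIV f"
  shows "continuous_on UNIV (adj f)"
  using continuous_on_reflect[OF assms, of 0] by (simp add: adj_def continuous_on_cnj)

lemma continuous_on_conv [simp]:
  assumes "continuous_on UNIV f" "continuous_on UNIV g"
  shows "continuous_on UNIV (f \<odot> g)"
  unfolding conv_def
  by (intro continuous_on_integral_section continuous_on_mult continuous_on_UNIV_compose[OF assms(1)]
      continuous_on_UNIV_compose[OF assms(2)] continuous_intros)

lemma integrable_conv:
  fixes f g :: "'a \<Rightarrow> complex"
  assumes "continuous_on UNIV f" "continuous_on UNIV g"
  shows "integrable \<mu> (\<lambda>y. f y * g (x - y))"
  by (intro integrable_haar_continuous continuous_on_mult assms continuous_on_reflect)

lemma conv_commute:
  assumes f: "continuous_on UNIV f" and g: "continuous_on UNIV g"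
  shows "f \<odot> g = g \<odot> f"
proof
  fix x
  have "continuous_on UNIV (\<lambda>y. g y * f (x - y))"
    by (intro continuous_on_mult g continuous_on_reflect f)
  from integral_reflection[OF this, of x] show "(f \<odot> g) x = (g \<odot> f) x"
    by (simp add: conv_def mult.commute)
qed

lemma conv_assoc:
  assumes f: "continuous_on UNIV f" and g: "continuous_on UNIV g" and h: "continuous_on UNIV h"
  shows "(f \<odot> g) \<odot> h = f \<odot> (g \<odot> h)"
proof
  fix x
  have c: "continuous_on UNIV (\<lambda>p. f (snd p) * g (fst p - snd p) * h (x - fst p))"
    by (intro continuous_on_mult continuous_on_UNIV_compose[OF f]
      continuous_on_UNIV_compose[OF g] continuous_on_UNIV_compose[OF h] continuous_intros)
  have c': "continuous_on UNIV (\<lambda>z. g z * h (x - y - z))" for y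
    by (intro continuous_on_mult g continuous_on_reflect h)
  have "((f \<odot> g) \<odot> h) x = (\<integral>y. (\<integral>z. f z * g (y - z) * h (x - y) \<partial>\<mu>) \<partial>\<mu>)"
    unfolding conv_def by (simp flip: integral_mult_left_zero)
  also have "\<dots> = (\<integral>z. (\<integral>y. f z * g (y - z) * h (x - y) \<partial>\<mu>) \<partial>\<mu>)"
    by (rule fubini_continuous[OF c])
  also have "\<dots> = (\<integral>z. f z * (\<integral>y. g (y - z) * h (x - y) \<partial>\<mu>) \<partial>\<mu>)"
    by (simp add: mult.assoc)
  also have "(\<lambda>z. \<integral>y. g (y - z) * h (x - y) \<partial>\<mu>) = (\<lambda>z. \<integral>y. g y * h (x - z - y) \<partial>\<mu>)"
  proof
    fix z
    show "(\<integral>y. g (y - z) * h (x - y) \<partial>\<mu>) = (\<integral>y. g y * h (x - z - y) \<partial>\<mu>)"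
      using integral_translation[OF c', of "- z" z] by (simp add: algebra_simps)
  qed
  finally show "((f \<odot> g) \<odot> h) x = (f \<odot> (g \<odot> h)) x" by (simp add: conv_def)
qed

lemma adj_conv:
  assumes f: "continuous_on UNIV f" and g: "continuous_on UNIV g"
  shows "adj (f \<odot> g) = adj f \<odot> adj g"
proof
  fix x
  have "continuous_on UNIV (\<lambda>y. cnj (f y * g (- x - y)))"
    by (intro continuous_intros f continuous_on_reflect g)
  from integral_uminus[OF this] show "adj (f \<odot> g) x = (adj f \<odot> adj g) x"
    by (simp add: conv_def adj_def flip: Bochner_Integration.integral_cnj)
qed

lemma conv_add_left:
  assumes "continuous_on UNIV f" "continuous_on UNIV g" "continuous_on UNIV h"
  shows "(\<lambda>x. f x + g x) \<odot> h = (\<lambda>x. (f \<odot> h) x + (g \<odot> h) x)"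
  by (simp add: conv_def distrib_right
      Bochner_Integration.integral_add[OF integrable_conv[OF assms(1,3)] integrable_conv[OF assms(2,3)]])

lemma conv_diff_left:
  assumes "continuous_on UNIV f" "continuous_on UNIV g" "continuous_on UNIV h"
  shows "(\<lambda>x. f x - g x) \<odot> h = (\<lambda>x. (f \<odot> h) x - (g \<odot> h) x)"
  by (simp add: conv_def left_diff_distrib
      Bochner_Integration.integral_diff[OF integrable_conv[OF assms(1,3)] integrable_conv[OF assms(2,3)]])

lemma conv_add_right:
  assumes "continuous_on UNIV f" "continuous_on UNIV g" "continuous_on UNIV h"
  shows "h \<odot> (\<lambda>x. f x + g x) = (\<lambda>x. (h \<odot> f) x + (h \<odot> g) x)"
  by (simp add: conv_def distrib_left
      Bochner_Integration.integral_add[OF integrable_conv[OF assms(3,1)] integrable_conv[OF assms(3,2)]])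

lemma conv_diff_right:
  assumes "continuous_on UNIV f" "continuous_on UNIV g" "continuous_on UNIV h"
  shows "h \<odot> (\<lambda>x. f x - g x) = (\<lambda>x. (h \<odot> f) x - (h \<odot> g) x)"
  by (simp add: conv_def right_diff_distrib
      Bochner_Integration.integral_diff[OF integrable_conv[OF assms(3,1)] integrable_conv[OF assms(3,2)]])

lemma conv_scale_left: "(\<lambda>x. c * f x) \<odot> g = (\<lambda>x. c * (f \<odot> g) x)"
  by (simp add: conv_def mult.assoc)

lemma conv_scale_right: "f \<odot> (\<lambda>x. c * g x) = (\<lambda>x. c * (f \<odot> g) x)"
  by (simp add: conv_def mult.left_commute)

lemma conv_zero_right [simp]: "f \<odot> (\<lambda>x. 0) = (\<lambda>x. 0)"
  by (simp add: conv_def)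

lemma conv_translate_left:
  assumes f: "continuous_on UNIV f" and g: "continuous_on UNIV g"
  shows "(\<lambda>x. f (x + a)) \<odot> g = (\<lambda>x. (f \<odot> g) (x + a))"
proof
  fix x
  have "continuous_on UNIV (\<lambda>y. f y * g (x + a - y))"
    by (intro continuous_on_mult f continuous_on_reflect g)
  from integral_translation[OF this, of a] show "((\<lambda>x. f (x + a)) \<odot> g) x = (f \<odot> g) (x + a)"
    by (simp add: conv_def add.commute)
qed

section \<open>The square norm and pointwise bounds for convolutions\<close>

lemma norm2sq_nonneg: "norm2sq f \<ge> 0"
  by (simp add: norm2sq_def)

lemma norm2sq_pos:
  assumes "continuous_on UNIV f" "f \<noteq> (\<lambda>x. 0)"
  shows "norm2sq f > 0"
proof -
  obtain x where "f x \<noteq> 0" using assms(2) by auto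
  moreover have "continuous_on UNIV (\<lambda>x. (norm (f x))\<^sup>2)"
    by (intro continuous_intros assms(1))
  ultimately have "norm2sq f \<noteq> 0"
    using integral_nonneg_continuous_eq_0[of "\<lambda>x. (norm (f x))\<^sup>2" x] by (auto simp: norm2sq_def)
  then show ?thesis using norm2sq_nonneg[of f] by simp
qed

text \<open>Square norms become values at 0, so they can be computed from the multiplication rules
  of convolution.\<close>

lemma conv_adj_0: "(f \<odot> adj f) 0 = complex_of_real (norm2sq f)"
  by (simp add: conv_def adj_def norm2sq_def complex_norm_square del: of_real_power flip: integral_complex_of_real)

lemma hermitian_conv_0: "adj f = f \<Longrightarrow> (f \<odot> f) 0 = complex_of_real (norm2sq f)"
  using conv_adj_0[of f] by simp

lemma Cauchy_Schwarz_integral: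
  fixes f g :: "'a \<Rightarrow> real"
  assumes f: "continuous_on UNIV f" and g: "continuous_on UNIV g"
  shows "(\<integral>x. f x * g x \<partial>\<mu>)\<^sup>2 \<le> (\<integral>x. (f x)\<^sup>2 \<partial>\<mu>) * (\<integral>x. (g x)\<^sup>2 \<partial>\<mu>)"
proof -
  define a b z where "a = (\<integral>x. (f x)\<^sup>2 \<partial>\<mu>)" and "b = (\<integral>x. (g x)\<^sup>2 \<partial>\<mu>)"
    and "z = (\<integral>x. f x * g x \<partial>\<mu>)"
  have i: "integrable \<mu> (\<lambda>x. (f x)\<^sup>2)" "integrable \<mu> (\<lambda>x. (g x)\<^sup>2)" "integrable \<mu> (\<lambda>x. f x * g x)"
    by (intro integrable_haar_continuous continuous_intros f g)+
  \<comment> \<open>These weights avoid division: the integral expands to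
    \<open>b * (a * b - z\<^sup>2)\<close>. For \<open>b = 0\<close> continuity forces
    \<open>g\<close> to vanish.\<close>
  have "0 \<le> (\<integral>x. (b * f x - z * g x)\<^sup>2 \<partial>\<mu>)" by simp
  also have "\<dots> = (\<integral>x. b\<^sup>2 * (f x)\<^sup>2 - 2 * b * z * (f x * g x) + z\<^sup>2 * (g x)\<^sup>2 \<partial>\<mu>)"
    by (simp add: power2_eq_square algebra_simps)
  also have "\<dots> = b\<^sup>2 * a - 2 * b * z * z + z\<^sup>2 * b"
    using i by (simp add: a_def b_def z_def)
  finally have *: "0 \<le> b * (a * b - z\<^sup>2)" by (simp add: power2_eq_square algebra_simps)
  have "b \<ge> 0" by (simp add: b_def)
  show ?thesis
  proof (cases "b = 0")
    case True
    have "continuous_on UNIV (\<lambda>x. (g x)\<^sup>2)" by (intro continuous_intros g)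
    from integral_nonneg_continuous_eq_0[OF this] True have "g x = 0" for x by (simp add: b_def)
    then show ?thesis by simp
  next
    case False
    with \<open>b \<ge> 0\<close> * show ?thesis
      by (simp add: zero_le_mult_iff flip: a_def b_def z_def)
  qed
qed

text \<open>Cauchy-Schwarz, where reflection invariance gives \<open>g (x - y)\<close> the norm of
  \<open>g\<close>. It serves to upgrade convergence in square norm to uniform convergence at the
  cost of one more convolution.\<close>

lemma norm_conv_sq_le:
  assumes f: "continuous_on UNIV f" and g: "continuous_on UNIV g"
  shows "(norm ((f \<odot> g) x))\<^sup>2 \<le> norm2sq f * norm2sq g"
proof -
  have c: "continuous_on UNIV (\<lambda>y. complex_of_real ((norm (g y))\<^sup>2))"
    by (intro continuous_intros g)
  have g_norm: "(\<integral>y. (norm (g (x - y)))\<^sup>2 \<partial>\<mu>) = norm2sq g"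
    using integral_reflection[OF c, of x]
    by (simp add: norm2sq_def del: of_real_power)
  have "(norm ((f \<odot> g) x))\<^sup>2 \<le> (\<integral>y. norm (f y) * norm (g (x - y)) \<partial>\<mu>)\<^sup>2"
    unfolding conv_def using integral_norm_bound[of \<mu> "\<lambda>y. f y * g (x - y)"]
    by (intro power_mono) (auto simp: norm_mult)
  also have "\<dots> \<le> (\<integral>y. (norm (f y))\<^sup>2 \<partial>\<mu>) * (\<integral>y. (norm (g (x - y)))\<^sup>2 \<partial>\<mu>)"
    by (intro Cauchy_Schwarz_integral continuous_on_norm f continuous_on_reflect g)
  also have "\<dots> = norm2sq f * norm2sq g" by (simp only: g_norm norm2sq_def)
  finally show ?thesis .
qed

lemma norm_conv_le:
  assumes f: "continuous_on UNIV f" and g: "continuous_on UNIV g"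
    and A: "\<And>x. norm (f x) \<le> A" and B: "\<And>x. norm (g x) \<le> B"
  shows "norm ((f \<odot> g) x) \<le> A * B"
proof -
  have "norm (f y * g (x - y)) \<le> A * B" for y
    unfolding norm_mult by (intro mult_mono A B) (auto intro: order_trans[OF norm_ge_zero A])
  then show ?thesis
    using norm_integral_diff_le[OF integrable_conv[OF f g, of x], of "\<lambda>_. 0" "A * B"]
    by (simp add: conv_def)
qed

lemma tendsto_conv_uniform_limit:
  assumes F: "uniform_limit UNIV E F sequentially" and g: "continuous_on UNIV g"
    and E: "\<And>n. continuous_on UNIV (E n)" and F_cont: "continuous_on UNIV F"
  shows "(\<lambda>n. (g \<odot> E n) x) \<longlonglongrightarrow> (g \<odot> F) x"
proof (rule metric_LIMSEQ_I)
  fix r :: real assume "r > 0"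
  obtain B where B: "\<And>x. norm (g x) \<le> B" using bounded_continuous[OF g] by blast
  have "B \<ge> 0" using order_trans[OF norm_ge_zero B] by blast
  then have e: "r / (B + 1) > 0" using \<open>r > 0\<close> by simp
  obtain N where N: "\<And>n x. n \<ge> N \<Longrightarrow> norm (E n x - F x) < r / (B + 1)"
    using uniform_limitD[OF F e] by (auto simp: eventually_sequentially dist_norm)
  have "norm ((g \<odot> E n) x - (g \<odot> F) x) < r" if "n \<ge> N" for n
  proof -
    have "norm ((g \<odot> (\<lambda>x. E n x - F x)) x) \<le> B * (r / (B + 1))"
      by (intro norm_conv_le g continuous_on_diff E F_cont B less_imp_le[OF N[OF that]])
    also have "\<dots> < r" using \<open>B \<ge> 0\<close> \<open>r > 0\<close> by (simp add: field_simps)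
    finally show ?thesis by (simp add: conv_diff_right E F_cont g)
  qed
  then show "\<exists>N. \<forall>n\<ge>N. dist ((g \<odot> E n) x) ((g \<odot> F) x) < r" by (auto simp: dist_norm)
qed

text \<open>Since \<open>\<gamma> (x - y)\<close> splits as
  \<open>\<gamma> x * cnj (\<gamma> y)\<close>, a character is an eigenvector of convolution by
  \<open>f\<close>, with the transform as eigenvalue.\<close>

lemma conv_character:
  assumes "\<gamma> \<in> dual_group"
  shows "f \<odot> \<gamma> = (\<lambda>x. fourier_transform \<mu> f \<gamma> * \<gamma> x)"
proof
  fix x
  have "(\<lambda>y. f y * \<gamma> (x - y)) = (\<lambda>y. f y * cnj (\<gamma> y) * \<gamma> x)"
    using dual_group_add[OF assms, of x "- _"] by (simp add: dual_group_uminus[OF assms] mult_ac)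
  then show "(f \<odot> \<gamma>) x = fourier_transform \<mu> f \<gamma> * \<gamma> x"
    by (simp add: conv_def fourier_transform_def)
qed

end

section \<open>Power iteration\<close>

text \<open>Log-convexity makes the ratios \<open>\<alpha> (Suc n) / \<alpha> n\<close> increase,
  and submultiplicativity bounds them by \<open>\<alpha> 0\<close>; \<open>l\<close> is their limit.
  The index is shifted because \<open>\<alpha> n\<close> will be the square norm of a power with
  \<open>n + 1\<close> factors.\<close>

lemma log_convex_submultiplicative_rate:
  fixes \<alpha> :: "nat \<Rightarrow> real"
  assumes pos: "\<And>n. \<alpha> n > 0"
    and log_convex: "\<And>n. (\<alpha> (Suc n))\<^sup>2 \<le> \<alpha> n * \<alpha> (Suc (Suc n))"
    and submult: "\<And>m n. \<alpha> (Suc (m + n)) \<le> \<alpha> m * \<alpha> n"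
  obtains l where "l > 0" "\<And>n. l ^ Suc n \<le> \<alpha> n" "\<And>n. \<alpha> (Suc n) \<le> l * \<alpha> n"
proof -
  define r where "r n = \<alpha> (Suc n) / \<alpha> n" for n
  have inc: "incseq r"
  proof (rule incseq_SucI)
    fix n
    show "r n \<le> r (Suc n)"
      using log_convex[of n] pos[of n] pos[of "Suc n"]
      by (simp add: r_def field_simps power2_eq_square)
  qed
  have "r n \<le> \<alpha> 0" for n
    using submult[of 0 n] pos[of n] by (simp add: r_def field_simps)
  then obtain l where l: "r \<longlonglongrightarrow> l" "\<And>n. r n \<le> l"
    using incseq_convergent[OF inc] by metis
  have "r 0 > 0" using pos by (simp add: r_def)
  then have "l > 0" using l(2)[of 0] by simp
  moreover have "\<alpha> (Suc n) \<le> l * \<alpha> n" for n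
    using l(2)[of n] pos[of n] by (simp add: r_def field_simps)
  moreover have "l ^ Suc m \<le> \<alpha> m" for m
  proof -
    \<comment> \<open>The quotient telescopes into \<open>m + 1\<close> consecutive ratios, each
      tending to \<open>l\<close>, while submultiplicativity keeps it below
      \<open>\<alpha> m\<close>.\<close>
    have "(\<lambda>n. \<alpha> (Suc (n + m)) / \<alpha> n) \<longlonglongrightarrow> l ^ Suc m"
    proof (induction m)
      case 0
      then show ?case using l(1) by (simp add: r_def[abs_def])
    next
      case (Suc m)
      have "(\<lambda>n. r (n + Suc m) * (\<alpha> (Suc (n + m)) / \<alpha> n)) \<longlonglongrightarrow> l * l ^ Suc m"
        by (intro tendsto_mult Suc LIMSEQ_ignore_initial_segment l)
      moreover have "r (n + Suc m) * (\<alpha> (Suc (n + m)) / \<alpha> n) = \<alpha> (Suc (n + Suc m)) / \<alpha> n" for n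
        using pos[of "Suc (n + m)"] by (simp add: r_def)
      ultimately show ?case by (simp only: power_Suc)
    qed
    moreover have "\<alpha> (Suc (n + m)) / \<alpha> n \<le> \<alpha> m" for n
      using submult[of n m] pos[of n] by (simp add: field_simps)
    ultimately show ?thesis by (intro LIMSEQ_le_const2) auto
  qed
  ultimately show ?thesis using that by blast
qed

context compact_abelian_haar
begin

text \<open>On the Fourier side the transform takes only the values 0 and 1: such an
  \<open>F\<close> is a nonempty finite sum of distinct characters.\<close>

definition conv_idempotent :: "('a \<Rightarrow> complex) \<Rightarrow> bool" where
  "conv_idempotent F \<longleftrightarrow> continuous_on UNIV F \<and> adj F = F \<and> F \<odot> F = F \<and> F \<noteq> (\<lambda>x. 0)"

text \<open>On the Fourier side the even convolution powers of \<open>h\<close>, suitably normalised, single out the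
  characters at which the transform of \<open>h\<close> has maximal modulus: \<open>F\<close> is their sum and \<open>l\<close> the square
  of the maximum.\<close>

lemma power_iteration:
  assumes h: "continuous_on UNIV h" and herm: "adj h = h" and nz: "h \<noteq> (\<lambda>x. 0)"
  obtains F l where "conv_idempotent F" "l \<noteq> 0" "(h \<odot> h) \<odot> F = (\<lambda>x. l * F x)"
proof -
  \<comment> \<open>\<open>p n\<close> is the convolution power with \<open>n + 1\<close> factors,
    whence the \<open>Suc\<close> in \<open>p_conv\<close>.\<close>
  define p where "p n = ((\<odot>) h ^^ n) h" for n
  have p_0: "p 0 = h" and p_Suc: "p (Suc n) = h \<odot> p n" for n by (simp_all add: p_def)
  have p_cont [simp]: "continuous_on UNIV (p n)" for n
    by (induction n) (simp_all add: p_0 p_Suc h)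
  have p_herm: "adj (p n) = p n" for n
    by (induction n) (simp_all add: p_0 p_Suc h herm adj_conv)
  have p_conv: "p m \<odot> p n = p (Suc (m + n))" for m n
    by (induction m) (simp_all add: p_0 p_Suc h conv_assoc)
  define \<alpha> where "\<alpha> n = norm2sq (p n)" for n
  \<comment> \<open>The even powers \<open>p n \<odot> p n\<close>: their values at 0 are the square
    norms \<open>\<alpha> n\<close>, which bound them everywhere.\<close>
  define e where "e n = p (Suc (n + n))" for n
  have e_cont [simp]: "continuous_on UNIV (e n)" for n by (simp add: e_def)
  have e_0: "e n 0 = of_real (\<alpha> n)" for n
    using hermitian_conv_0[OF p_herm] by (simp add: e_def \<alpha>_def flip: p_conv)
  have e_conv: "e m \<odot> e n = e (Suc (m + n))" for m n
    by (simp add: e_def p_conv algebra_simps)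
  have \<alpha>_nonneg: "\<alpha> n \<ge> 0" for n by (simp add: \<alpha>_def norm2sq_nonneg)
  have e_le: "norm (e n x) \<le> \<alpha> n" for n x
  proof (rule power2_le_imp_le[OF _ \<alpha>_nonneg])
    show "(norm (e n x))\<^sup>2 \<le> (\<alpha> n)\<^sup>2"
      using norm_conv_sq_le[of "p n" "p n" x] by (simp add: e_def p_conv \<alpha>_def power2_eq_square)
  qed
  \<comment> \<open>Cauchy-Schwarz for \<open>p n\<close> and \<open>p (n + 2)\<close>, whose
    convolution is \<open>e (n + 1)\<close>.\<close>
  have log_convex: "(\<alpha> (Suc n))\<^sup>2 \<le> \<alpha> n * \<alpha> (Suc (Suc n))" for n
  proof -
    have "(p n \<odot> p (Suc (Suc n))) 0 = of_real (\<alpha> (Suc n))"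
      using e_0[of "Suc n"] by (simp add: e_def p_conv)
    then show ?thesis
      using norm_conv_sq_le[of "p n" "p (Suc (Suc n))" 0] by (simp add: \<alpha>_def norm2sq_nonneg)
  qed
  have submult: "\<alpha> (Suc (m + n)) \<le> \<alpha> m * \<alpha> n" for m n
  proof -
    have "norm ((e m \<odot> e n) 0) \<le> \<alpha> m * \<alpha> n" by (intro norm_conv_le e_le e_cont)
    then show ?thesis using \<alpha>_nonneg by (simp add: e_conv e_0)
  qed
  have \<alpha>_01: "\<alpha> 0 > 0" "\<alpha> (Suc 0) > 0"
  proof -
    show "\<alpha> 0 > 0" using norm2sq_pos[OF h nz] by (simp add: \<alpha>_def p_0)
    then have "p (Suc 0) \<noteq> (\<lambda>x. 0)" using e_0[of 0] by (auto simp: e_def)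
    then show "\<alpha> (Suc 0) > 0" unfolding \<alpha>_def by (intro norm2sq_pos) auto
  qed
  have \<alpha>_pos: "\<alpha> n > 0" for n
  proof (induction n rule: induct_nat_012)
    case (ge2 n)
    then have "0 < \<alpha> n * \<alpha> (Suc (Suc n))" using log_convex[of n] by (smt (verit) zero_less_power)
    then show ?case using ge2 by (simp add: zero_less_mult_iff)
  qed (use \<alpha>_01 in auto)
  obtain l where l: "l > 0" "\<And>n. l ^ Suc n \<le> \<alpha> n" "\<And>n. \<alpha> (Suc n) \<le> l * \<alpha> n"
    using log_convex_submultiplicative_rate[OF \<alpha>_pos log_convex submult] by metis
  \<comment> \<open>The values at 0 of the normalised powers. Their convergence drives the Cauchy
    estimate, and the lower bound 1 keeps the limit nonzero.\<close>
  define b where "b n = \<alpha> n / l ^ Suc n" for n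
  have b_ge: "b n \<ge> 1" for n using l by (simp add: b_def divide_simps)
  have "decseq b"
  proof (rule decseq_SucI)
    fix n show "b (Suc n) \<le> b n" using l(1) l(3)[of n] by (simp add: b_def divide_simps mult_ac)
  qed
  then obtain B where B: "b \<longlonglongrightarrow> B" using b_ge by (metis decseq_convergent)
  define E where "E n = (\<lambda>x. of_real (inverse (l ^ Suc n)) * e n x)" for n
  have E_cont [simp]: "continuous_on UNIV (E n)" for n
    unfolding E_def by (intro continuous_intros e_cont)
  have E_herm: "adj (E n) x = E n x" for n x
    using fun_cong[OF p_herm[of "Suc (n + n)"], of x] by (simp add: E_def e_def adj_def)
  have E_conv: "E m \<odot> E n = E (Suc (m + n))" for m n
    unfolding E_def conv_scale_left conv_scale_right e_conv by (simp add: power_add mult_ac)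
  have E_0: "E n 0 = of_real (b n)" for n by (simp add: E_def e_0 b_def divide_inverse mult.commute)
  \<comment> \<open>The difference is self-adjoint, so its square norm is the value at 0 of its
    convolution square. The limits of the three terms cancel.\<close>
  have E_diff: "norm2sq (\<lambda>x. E m x - E n x) = b (Suc (m + m)) - 2 * b (Suc (m + n)) + b (Suc (n + n))" for m n
  proof -
    have "adj (\<lambda>x. E m x - E n x) = (\<lambda>x. E m x - E n x)"
      using E_herm by (auto simp: adj_def)
    from hermitian_conv_0[OF this]
    have "complex_of_real (norm2sq (\<lambda>x. E m x - E n x)) =
        of_real (b (Suc (m + m)) - 2 * b (Suc (m + n)) + b (Suc (n + n)))"
      by (simp add: conv_diff_left conv_diff_right continuous_on_diff E_conv E_0 algebra_simps)
    then show ?thesis by (simp only: of_real_eq_iff)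
  qed
  define c where "c = norm2sq (E 0)"
  have "c > 0" unfolding c_def
  proof (rule norm2sq_pos)
    show "E 0 \<noteq> (\<lambda>x. 0)" using E_0[of 0] b_ge[of 0] by auto
  qed simp
  \<comment> \<open>Since \<open>E (Suc m) = E 0 \<odot> E m\<close>, the extra factor
    \<open>E 0\<close> turns the Cauchy property in square norm into a uniform one.\<close>
  have "uniformly_Cauchy_on UNIV (\<lambda>n. E (Suc n))"
  proof (rule uniformly_Cauchy_onI)
    fix \<epsilon> :: real assume "\<epsilon> > 0"
    \<comment> \<open>The terms of \<open>E_diff\<close> have total weight 4 and each
      \<open>b\<close> is within \<open>\<delta>\<close> of \<open>B\<close>, so the bound
      \<open>c * (4 * \<delta>)\<close> is half of \<open>\<epsilon>\<^sup>2\<close>.\<close>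
    define \<delta> where "\<delta> = \<epsilon>\<^sup>2 / (8 * c)"
    have "\<delta> > 0" using \<open>\<epsilon> > 0\<close> \<open>c > 0\<close> by (simp add: \<delta>_def)
    from metric_LIMSEQ_D[OF B this] obtain N where N: "\<And>n. n \<ge> N \<Longrightarrow> \<bar>b n - B\<bar> < \<delta>"
      by (auto simp: dist_real_def)
    have "dist (E (Suc m) x) (E (Suc n) x) < \<epsilon>" if "m \<ge> N" "n \<ge> N" for m n x
    proof (rule power2_less_imp_less)
      have "(norm ((E 0 \<odot> (\<lambda>x. E m x - E n x)) x))\<^sup>2 \<le> c * norm2sq (\<lambda>x. E m x - E n x)"
        unfolding c_def by (intro norm_conv_sq_le continuous_on_diff E_cont)
      also have "\<dots> \<le> c * (4 * \<delta>)"
        using \<open>c > 0\<close> N[of "Suc (m + m)"] N[of "Suc (m + n)"] N[of "Suc (n + n)"] that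
        unfolding E_diff by (intro mult_left_mono) auto
      also have "\<dots> = \<epsilon>\<^sup>2 / 2" using \<open>c > 0\<close> by (simp add: \<delta>_def)
      also have "\<dots> < \<epsilon>\<^sup>2" using \<open>\<epsilon> > 0\<close> by simp
      finally show "(dist (E (Suc m) x) (E (Suc n) x))\<^sup>2 < \<epsilon>\<^sup>2"
        by (simp add: conv_diff_right E_conv dist_norm)
    qed (use \<open>\<epsilon> > 0\<close> in simp)
    then show "\<exists>M. \<forall>x\<in>UNIV. \<forall>m\<ge>M. \<forall>n\<ge>M. dist (E (Suc m) x) (E (Suc n) x) < \<epsilon>" by blast
  qed
  then obtain F where F: "uniform_limit UNIV (\<lambda>n. E (Suc n)) F sequentially"
    using Cauchy_uniformly_convergent unfolding uniformly_convergent_on_def by blast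
  have F_cont: "continuous_on UNIV F"
    by (rule uniform_limit_theorem[OF _ F]) auto
  have F_lim: "(\<lambda>n. E (Suc n) x) \<longlonglongrightarrow> F x" for x
    using tendsto_uniform_limitI[OF F] by simp
  have F_0: "F 0 \<noteq> 0"
  proof -
    have "(\<lambda>n. Re (E (Suc n) 0)) \<longlonglongrightarrow> Re (F 0)" by (intro tendsto_Re F_lim)
    then have "1 \<le> Re (F 0)" by (rule LIMSEQ_le_const) (use E_0 b_ge in auto)
    then show ?thesis by auto
  qed
  have F_herm: "adj F = F"
  proof
    fix x
    have "(\<lambda>n. adj (E (Suc n)) x) \<longlonglongrightarrow> adj F x"
      unfolding adj_def by (intro tendsto_cnj F_lim)
    then have "(\<lambda>n. E (Suc n) x) \<longlonglongrightarrow> adj F x" by (simp only: E_herm)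
    then show "adj F x = F x" using F_lim LIMSEQ_unique by blast
  qed
  \<comment> \<open>Convolution by \<open>E m\<close> only shifts the index of the sequence, so it
    fixes the limit.\<close>
  have E_F: "E m \<odot> F = F" for m
  proof
    fix x
    have "(\<lambda>n. (E m \<odot> E (Suc n)) x) \<longlonglongrightarrow> (E m \<odot> F) x"
      by (intro tendsto_conv_uniform_limit F E_cont F_cont)
    moreover have "(\<lambda>n. E (Suc (n + Suc m)) x) \<longlonglongrightarrow> F x"
      by (rule LIMSEQ_ignore_initial_segment[OF F_lim])
    ultimately show "(E m \<odot> F) x = F x"
      by (simp add: E_conv add.commute LIMSEQ_unique)
  qed
  have F_F: "F \<odot> F = F"
  proof
    fix x
    have "(\<lambda>n. (F \<odot> E (Suc n)) x) \<longlonglongrightarrow> (F \<odot> F) x"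
      by (intro tendsto_conv_uniform_limit F E_cont F_cont)
    moreover have "F \<odot> E (Suc n) = F" for n
      using E_F conv_commute[OF F_cont E_cont] by simp
    ultimately show "(F \<odot> F) x = F x" by (simp add: LIMSEQ_const_iff)
  qed
  have "h \<odot> h = (\<lambda>x. of_real l * E 0 x)"
    using l(1) by (simp add: E_def e_def p_Suc p_0 flip: mult.assoc)
  then have "(h \<odot> h) \<odot> F = (\<lambda>x. of_real l * F x)"
    by (simp add: conv_scale_left E_F)
  moreover have "conv_idempotent F"
    unfolding conv_idempotent_def using F_cont F_herm F_F F_0 by (auto simp: fun_eq_iff)
  ultimately show ?thesis using that[of F "of_real l"] l(1) by simp
qed

end

section \<open>Minimal idempotents and characters\<close>

context compact_abelian_haar
begin

text \<open>\<open>F 0\<close> is the square norm \<open>a\<close> of \<open>F\<close>.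
  Cauchy-Schwarz bounds \<open>F = F \<odot> F\<close> by \<open>a\<close>, and the uniform bound on
  the convolution then gives \<open>a \<le> a * a\<close>.\<close>

lemma conv_idempotent_0:
  assumes "conv_idempotent F"
  shows "norm (F x) \<le> Re (F 0)" "Re (F 0) \<ge> 1" "F 0 \<noteq> 0"
proof -
  have F: "continuous_on UNIV F" "adj F = F" "F \<odot> F = F" "F \<noteq> (\<lambda>x. 0)"
    using assms by (auto simp: conv_idempotent_def)
  define a where "a = norm2sq F"
  have F_0: "F 0 = of_real a" using hermitian_conv_0[OF F(2)] F(3) by (simp add: a_def)
  have a: "a > 0" using norm2sq_pos[OF F(1,4)] by (simp add: a_def)
  have le: "norm (F x) \<le> a" for x
  proof (rule power2_le_imp_le)
    show "(norm (F x))\<^sup>2 \<le> a\<^sup>2"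
      using norm_conv_sq_le[OF F(1) F(1), of x] F(3) by (simp add: a_def power2_eq_square)
  qed (use a in simp)
  have "a \<le> a * a"
    using norm_conv_le[OF F(1) F(1) le le, of 0] F(3) F_0 a by simp
  then show "norm (F x) \<le> Re (F 0)" "Re (F 0) \<ge> 1" "F 0 \<noteq> 0"
    using le a F_0 by simp_all
qed

text \<open>Splitting an idempotent into two decreases the value at 0, which counts the characters
  it is made of, by at least 1; hence a splitting process must stop.\<close>

lemma minimal_idempotent_below:
  assumes F0: "conv_idempotent F0"
  obtains F where "conv_idempotent F" "F \<odot> F0 = F"
    "\<And>P. conv_idempotent P \<Longrightarrow> P \<odot> F = P \<Longrightarrow> P = F"
proof -
  define S where "S F \<longleftrightarrow> conv_idempotent F \<and> F \<odot> F0 = F" for F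
  define m where "m F = nat \<lfloor>Re (F 0)\<rfloor>" for F :: "'a \<Rightarrow> complex"
  have "S F0" using F0 by (simp add: S_def conv_idempotent_def)
  from ex_has_least_nat[of S, OF this, of m]
  obtain F where F: "S F" and least: "\<And>P. S P \<Longrightarrow> m F \<le> m P" by blast
  have F_id: "continuous_on UNIV F" "adj F = F" "F \<odot> F = F" "conv_idempotent F" "F \<odot> F0 = F"
    using F by (auto simp: S_def conv_idempotent_def)
  have F0_cont: "continuous_on UNIV F0" using F0 by (simp add: conv_idempotent_def)
  have "P = F" if P: "conv_idempotent P" "P \<odot> F = P" for P
  proof (rule ccontr)
    assume "P \<noteq> F"
    have P_id: "continuous_on UNIV P" "adj P = P" "P \<odot> P = P"
      using P by (auto simp: conv_idempotent_def)
    have "P \<odot> F0 = P"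
      using conv_assoc[OF P_id(1) F_id(1) F0_cont] P(2) F_id(5) by simp
    then have "S P" using P by (simp add: S_def)
    have FP: "F \<odot> P = P" using conv_commute[OF F_id(1) P_id(1)] P(2) by simp
    \<comment> \<open>The complement of \<open>P\<close> in \<open>F\<close> is again idempotent, so
      its value at 0 is at least 1 and \<open>m\<close> drops strictly from \<open>F\<close> to
      \<open>P\<close>.\<close>
    define Q where "Q = (\<lambda>x. F x - P x)"
    have "conv_idempotent Q"
      unfolding conv_idempotent_def
    proof (intro conjI)
      show "continuous_on UNIV Q" unfolding Q_def by (intro continuous_on_diff F_id P_id)
      show "adj Q = Q" using F_id(2) P_id(2) by (auto simp: Q_def adj_def fun_eq_iff)
      show "Q \<odot> Q = Q" unfolding Q_def
        by (simp add: conv_diff_left conv_diff_right continuous_on_diff F_id P_id FP P(2))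
      show "Q \<noteq> (\<lambda>x. 0)" using \<open>P \<noteq> F\<close> by (simp add: Q_def fun_eq_iff) metis
    qed
    from conv_idempotent_0(2)[OF this] have "Re (P 0) + 1 \<le> Re (F 0)" by (simp add: Q_def)
    moreover have "Re (P 0) \<ge> 1" using conv_idempotent_0(2)[OF P(1)] .
    ultimately have "m P < m F" unfolding m_def by linarith
    then show False using least[OF \<open>S P\<close>] by simp
  qed
  then show ?thesis using that F_id by blast
qed

text \<open>By minimality every continuous function fixed by convolution with \<open>F\<close> is a
  multiple of \<open>F\<close>. Translates of \<open>F\<close> are fixed, so
  \<open>F (x + a)\<close> is proportional to \<open>F x\<close>, which after division by
  \<open>F 0\<close> is multiplicativity.\<close>

lemma minimal_idempotent_character:
  assumes F: "conv_idempotent F" and minimal: "\<And>P. conv_idempotent P \<Longrightarrow> P \<odot> F = P \<Longrightarrow> P = F"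
  shows "(\<lambda>x. F x / F 0) \<in> dual_group"
proof -
  have F_id: "continuous_on UNIV F" "adj F = F" "F \<odot> F = F"
    using F by (auto simp: conv_idempotent_def)
  \<comment> \<open>Power iteration yields an idempotent \<open>P\<close> on which
    \<open>u \<odot> u\<close> acts as a nonzero scalar. As \<open>u \<odot> F = u\<close>, it lies
    below \<open>F\<close> and hence equals \<open>F\<close>.\<close>
  have square: "\<exists>c. u \<odot> u = (\<lambda>x. c * F x)"
    if u: "continuous_on UNIV u" "adj u = u" "u \<odot> F = u" for u
  proof (cases "u = (\<lambda>x. 0)")
    case True
    then show ?thesis by (intro exI[of _ 0]) (simp add: conv_def)
  next
    case False
    obtain P l where P: "conv_idempotent P" "l \<noteq> 0" "(u \<odot> u) \<odot> P = (\<lambda>x. l * P x)"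
      using power_iteration[OF u(1,2) False] by blast
    have P_cont: "continuous_on UNIV P" using P(1) by (simp add: conv_idempotent_def)
    have uuF: "(u \<odot> u) \<odot> F = u \<odot> u" by (simp add: conv_assoc u F_id)
    have "(\<lambda>x. l * (P \<odot> F) x) = ((u \<odot> u) \<odot> P) \<odot> F" by (simp add: P(3) conv_scale_left)
    also have "\<dots> = ((u \<odot> u) \<odot> F) \<odot> P"
      using u(1) P_cont F_id(1)
      by (simp only: conv_assoc[of "u \<odot> u"] continuous_on_conv conv_commute[of P F])
    also have "\<dots> = (\<lambda>x. l * P x)" by (simp add: uuF P(3))
    finally have "P \<odot> F = P" using P(2) by (simp add: fun_eq_iff)
    then have "P = F" using minimal P(1) by blast
    then show ?thesis using P(3) uuF by metis
  qed
  have hermitian: "\<exists>c. u = (\<lambda>x. c * F x)"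
    if u: "continuous_on UNIV u" "adj u = u" "u \<odot> F = u" for u
  proof -
    \<comment> \<open>Polarisation: the square of \<open>u + F\<close> contains
      \<open>2 * u\<close>, and its other terms are multiples of \<open>F\<close>.\<close>
    define v where "v = (\<lambda>x. u x + F x)"
    have v: "continuous_on UNIV v" "adj v = v" "v \<odot> F = v"
      using u F_id by (auto simp: v_def adj_def fun_eq_iff conv_add_left intro!: continuous_on_add)
    have Fu: "F \<odot> u = u" using conv_commute[OF F_id(1) u(1)] u(3) by simp
    obtain c where c: "u \<odot> u = (\<lambda>x. c * F x)" using square[OF u] by blast
    obtain d where d: "v \<odot> v = (\<lambda>x. d * F x)" using square[OF v] by blast
    have "v \<odot> v = (\<lambda>x. c * F x + 2 * u x + F x)"
      unfolding v_def
      by (simp add: conv_add_left conv_add_right continuous_on_add u F_id Fu c algebra_simps)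
    with d have "c * F x + 2 * u x + F x = d * F x" for x by (metis (no_types))
    then have "u x = (d - c - 1) / 2 * F x" for x
      by (simp add: field_simps)
    then show ?thesis by blast
  qed
  have scalar: "\<exists>c. w = (\<lambda>x. c * F x)" if w: "continuous_on UNIV w" "w \<odot> F = w" for w
  proof -
    have aw: "adj w \<odot> F = adj w" using adj_conv[OF w(1) F_id(1)] w(2) F_id(2) by simp
    define u v where "u = (\<lambda>x. w x + adj w x)" and "v = (\<lambda>x. \<i> * (w x - adj w x))"
    have "\<exists>c. u = (\<lambda>x. c * F x)"
      by (rule hermitian)
        (simp_all add: u_def adj_def[of "\<lambda>x. _ x + _ x"] conv_add_left w aw F_id continuous_on_add add.commute,
          simp add: adj_def add.commute)
    moreover have "\<exists>c. v = (\<lambda>x. c * F x)"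
    proof (rule hermitian)
      show "continuous_on UNIV v" unfolding v_def by (intro continuous_intros continuous_on_adj w)
      show "adj v = v" by (simp add: v_def adj_def algebra_simps)
      show "v \<odot> F = v" by (simp add: v_def conv_scale_left conv_diff_left w aw F_id)
    qed
    ultimately obtain c d where cd: "u = (\<lambda>x. c * F x)" "v = (\<lambda>x. d * F x)" by blast
    have "w x = (u x - \<i> * v x) / 2" for x by (simp add: u_def v_def algebra_simps)
    then have "w x = (c - \<i> * d) / 2 * F x" for x by (simp add: cd algebra_simps)
    then show ?thesis by blast
  qed
  have translate: "F (x + a) * F 0 = F x * F a" for x a
  proof -
    have "(\<lambda>x. F (x + a)) \<odot> F = (\<lambda>x. F (x + a))"
      by (simp add: conv_translate_left F_id)
    from scalar[OF continuous_on_translate[OF F_id(1)] this]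
    obtain c where c: "\<And>x. F (x + a) = c * F x" by metis
    show ?thesis using c[of x] c[of 0] by simp
  qed
  note F_0 = conv_idempotent_0[OF F]
  define \<gamma> where "\<gamma> x = F x / F 0" for x
  have add: "\<gamma> (x + y) = \<gamma> x * \<gamma> y" for x y
    using translate[of x y] F_0(3) by (simp add: \<gamma>_def field_simps)
  have le: "norm (\<gamma> x) \<le> 1" for x
  proof -
    have "norm (F x) \<le> norm (F 0)" using F_0(1)[of x] complex_Re_le_cmod[of "F 0"] by linarith
    then show ?thesis using F_0(3) by (simp add: \<gamma>_def norm_divide)
  qed
  \<comment> \<open>\<open>\<gamma> x\<close> and \<open>\<gamma> (- x)\<close> have product 1, and
    neither modulus exceeds 1.\<close>
  have "norm (\<gamma> x) = 1" for x
  proof -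
    have "\<gamma> x * \<gamma> (- x) = 1" using add[of x "- x"] F_0(3) by (simp add: \<gamma>_def)
    then have "norm (\<gamma> x) * norm (\<gamma> (- x)) = 1" by (metis norm_mult norm_one)
    moreover have "norm (\<gamma> x) * norm (\<gamma> (- x)) \<le> norm (\<gamma> x)"
      using le[of "- x"] by (simp add: mult_left_le)
    ultimately show ?thesis using le[of x] by linarith
  qed
  moreover have "continuous_on UNIV \<gamma>"
    unfolding \<gamma>_def using F_0(3) by (intro continuous_intros F_id) auto
  ultimately show ?thesis using add by (simp add: dual_group_def \<gamma>_def[abs_def])
qed

text \<open>Let \<open>F\<close> be minimal below the idempotent \<open>F0\<close> obtained from
  \<open>h\<close>. It is a multiple of a character, so a vanishing transform of \<open>k\<close>
  makes \<open>k\<close>, and with it \<open>h\<close>, annihilate \<open>F\<close>; but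
  \<open>h \<odot> h\<close> acts on \<open>F\<close> as the nonzero scalar
  \<open>l\<close>.\<close>

theorem fourier_transform_injective:
  assumes k: "continuous_on UNIV k" and zero: "\<And>\<gamma>. \<gamma> \<in> dual_group \<Longrightarrow> fourier_transform \<mu> k \<gamma> = 0"
  shows "k = (\<lambda>x. 0)"
proof (rule ccontr)
  assume nz: "k \<noteq> (\<lambda>x. 0)"
  \<comment> \<open>This provides the self-adjointness needed for power iteration; the value at 0 is
    the square norm of \<open>k\<close>, hence nonzero.\<close>
  define h where "h = k \<odot> adj k"
  have h: "continuous_on UNIV h" by (simp add: h_def k)
  have herm: "adj h = h" by (simp add: h_def adj_conv k conv_commute)
  have "h 0 \<noteq> 0" using norm2sq_pos[OF k nz] by (simp add: h_def conv_adj_0)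
  then have "h \<noteq> (\<lambda>x. 0)" by auto
  from power_iteration[OF h herm this]
  obtain F0 l where F0: "conv_idempotent F0" "l \<noteq> 0" "(h \<odot> h) \<odot> F0 = (\<lambda>x. l * F0 x)" by blast
  obtain F where F: "conv_idempotent F" "F \<odot> F0 = F"
      "\<And>P. conv_idempotent P \<Longrightarrow> P \<odot> F = P \<Longrightarrow> P = F"
    using minimal_idempotent_below[OF F0(1)] by blast
  have cont: "continuous_on UNIV F" "continuous_on UNIV F0"
    using F F0 by (auto simp: conv_idempotent_def)
  define \<gamma> where "\<gamma> = (\<lambda>x. F x / F 0)"
  have \<gamma>: "\<gamma> \<in> dual_group" unfolding \<gamma>_def by (rule minimal_idempotent_character[OF F(1,3)])
  have "F 0 \<noteq> 0" using conv_idempotent_0(3)[OF F(1)] .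
  then have F_\<gamma>: "F = (\<lambda>x. F 0 * \<gamma> x)" by (simp add: \<gamma>_def)
  have "k \<odot> \<gamma> = (\<lambda>x. 0)" using conv_character[OF \<gamma>, of k] zero[OF \<gamma>] by simp
  then have kF: "k \<odot> F = (\<lambda>x. 0)" by (subst F_\<gamma>) (simp add: conv_scale_right)
  have "h \<odot> F = adj k \<odot> (k \<odot> F)"
    by (simp add: h_def conv_commute[of k "adj k"] conv_assoc k cont)
  also have "\<dots> = (\<lambda>x. 0)" by (simp add: kF)
  finally have hF: "h \<odot> F = (\<lambda>x. 0)" .
  have "(\<lambda>x. l * (F0 \<odot> F) x) = ((h \<odot> h) \<odot> F0) \<odot> F" by (simp add: F0(3) conv_scale_left)
  also have "\<dots> = (h \<odot> h) \<odot> (F \<odot> F0)"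
    by (simp add: conv_assoc h cont conv_commute[of F0 F])
  also have "\<dots> = (\<lambda>x. 0)" unfolding F(2) by (simp add: conv_assoc h cont hF)
  finally have "F0 \<odot> F = (\<lambda>x. 0)" using F0(2) by (simp add: fun_eq_iff)
  then have "F = (\<lambda>x. 0)" using F(2) conv_commute[of F0 F] cont by simp
  then show False using \<open>F 0 \<noteq> 0\<close> by (metis (full_types))
qed

end

section \<open>Positive definiteness\<close>

text \<open>Terms with coefficient 0 are dropped and the remaining indices enumerated to fit the
  definition. General index sets allow sums over pairs below.\<close>

lemma positive_definite_sum_nonneg:
  assumes f: "positive_definite f" and I: "finite I"
  shows "(\<Sum>i\<in>I. \<Sum>j\<in>I. c i * cnj (c j) * f (x i - x j)) \<ge> 0"
proof -
  define J where "J = {i \<in> I. c i \<noteq> 0}"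
  have J: "finite J" "J \<subseteq> I" using I by (auto simp: J_def)
  have "(\<Sum>i\<in>I. \<Sum>j\<in>I. c i * cnj (c j) * f (x i - x j)) = (\<Sum>i\<in>J. \<Sum>j\<in>I. c i * cnj (c j) * f (x i - x j))"
    by (rule sum.mono_neutral_right) (use I J in \<open>auto simp: J_def\<close>)
  also have "\<dots> = (\<Sum>i\<in>J. \<Sum>j\<in>J. c i * cnj (c j) * f (x i - x j))"
    by (intro sum.cong refl sum.mono_neutral_right) (use I J in \<open>auto simp: J_def\<close>)
  also have "\<dots> \<ge> 0"
  proof (cases "J = {}")
    case False
    obtain h where h: "bij_betw h {..<card J} J"
      using ex_bij_betw_nat_finite[OF J(1)] by (auto simp: atLeast0LessThan)
    have "card J \<ge> 1" using False J by (simp add: Suc_le_eq card_gt_0_iff)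
    moreover have "c (h i) \<noteq> 0" if "i < card J" for i
      using bij_betwE[OF h] that by (auto simp: J_def)
    ultimately have "0 \<le> (\<Sum>i<card J. \<Sum>j<card J. c (h i) * cnj (c (h j)) * f (x (h i) - x (h j)))"
      using f[unfolded positive_definite_def, rule_format, of "card J" "\<lambda>i. c (h i)" "\<lambda>i. x (h i)"] by simp
    also have "\<dots> = (\<Sum>i<card J. \<Sum>j\<in>J. c (h i) * cnj (c j) * f (x (h i) - x j))"
      by (intro sum.cong refl sum.reindex_bij_betw[OF h])
    also have "\<dots> = (\<Sum>i\<in>J. \<Sum>j\<in>J. c i * cnj (c j) * f (x i - x j))"
      by (rule sum.reindex_bij_betw[OF h])
    finally show ?thesis .
  qed simp
  finally show ?thesis .
qed

text \<open>Indexing by the points themselves makes their distinctness automatic.\<close>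

lemma strictly_positive_definite_sum_pos:
  assumes f: "strictly_positive_definite f" and Y: "finite Y" "Y \<noteq> {}" "\<And>y. y \<in> Y \<Longrightarrow> c y \<noteq> 0"
  shows "(\<Sum>y\<in>Y. \<Sum>z\<in>Y. c y * cnj (c z) * f (y - z)) > 0"
proof -
  obtain h where h: "bij_betw h {..<card Y} Y"
    using ex_bij_betw_nat_finite[OF Y(1)] by (auto simp: atLeast0LessThan)
  have "card Y \<ge> 1" using Y by (simp add: Suc_le_eq card_gt_0_iff)
  moreover have "c (h i) \<noteq> 0" if "i < card Y" for i
    using bij_betwE[OF h] that Y(3) by auto
  moreover have "inj_on h {..<card Y}" using h by (simp add: bij_betw_def)
  ultimately have "0 < (\<Sum>i<card Y. \<Sum>j<card Y. c (h i) * cnj (c (h j)) * f (h i - h j))"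
    using f[unfolded strictly_positive_definite_def, THEN conjunct2, rule_format,
        of "card Y" "\<lambda>i. c (h i)" h] by simp
  also have "\<dots> = (\<Sum>i<card Y. \<Sum>j\<in>Y. c (h i) * cnj (c j) * f (h i - j))"
    by (intro sum.cong refl sum.reindex_bij_betw[OF h])
  also have "\<dots> = (\<Sum>i\<in>Y. \<Sum>j\<in>Y. c i * cnj (c j) * f (i - j))"
    by (rule sum.reindex_bij_betw[OF h])
  finally show ?thesis .
qed

text \<open>The autocorrelation is itself positive definite, and a positive definite function is bounded
  by its value at 0.\<close>

lemma positive_definite_autocorrelation_eq_0:
  assumes f: "positive_definite f" and I: "finite I"
    and zero: "(\<Sum>i\<in>I. \<Sum>j\<in>I. c i * cnj (c j) * f (a i - a j)) = 0"
  shows "(\<Sum>i\<in>I. \<Sum>j\<in>I. c i * cnj (c j) * f (x + (a i - a j))) = 0"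
proof -
  define g where "g x = (\<Sum>i\<in>I. \<Sum>j\<in>I. c i * cnj (c j) * f (x + (a i - a j)))" for x
  have "0 \<le> t * g x + cnj t * g (- x)" for t
  proof -
    \<comment> \<open>The quadratic form on the points \<open>a i\<close> and \<open>x + a i\<close>
      with weights \<open>c i\<close> and \<open>t * c i\<close>. The two diagonal blocks are
      multiples of \<open>g 0\<close>, which is 0.\<close>
    define d where "d = (\<lambda>(i, b). if b then t * c i else c i)"
    define y where "y = (\<lambda>(i, b). if b then x + a i else a i)"
    have "0 \<le> (\<Sum>p\<in>I \<times> UNIV. \<Sum>q\<in>I \<times> UNIV. d p * cnj (d q) * f (y p - y q))"
      by (rule positive_definite_sum_nonneg[OF f]) (simp add: I)
    also have "\<dots> = (\<Sum>i\<in>I. \<Sum>b\<in>UNIV. \<Sum>j\<in>I. \<Sum>b'\<in>UNIV. d (i, b) * cnj (d (j, b')) * f (y (i, b) - y (j, b')))"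
      by (simp add: sum.cartesian_product')
    also have "\<dots> = (\<Sum>i\<in>I. \<Sum>j\<in>I. c i * cnj (c j) * f (a i - a j) + t * cnj t * (c i * cnj (c j) * f (a i - a j))
       + t * (c i * cnj (c j) * f (x + (a i - a j))) + cnj t * (c i * cnj (c j) * f (- x + (a i - a j))))"
      by (simp add: d_def y_def UNIV_bool sum.distrib algebra_simps)
    also have "\<dots> = g 0 + t * cnj t * g 0 + t * g x + cnj t * g (- x)"
      by (simp add: g_def sum.distrib sum_distrib_left)
    also have "g 0 = 0" using zero by (simp add: g_def)
    finally show ?thesis by simp
  qed
  \<comment> \<open>Opposite values of \<open>t\<close> force the expression to be 0:
    \<open>t = 1\<close> gives \<open>g x + g (- x) = 0\<close>, and \<open>t = \<i>\<close> gives
    \<open>g x - g (- x) = 0\<close>.\<close>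
  from this[of 1] this[of "- 1"] this[of \<i>] this[of "- \<i>"] have "g x = 0"
    by (auto simp: less_eq_complex_def complex_eq_iff)
  then show ?thesis by (simp add: g_def)
qed

text \<open>\<open>trig_poly\<close> allows repeated points. Merging them and discarding cancelled
  coefficients prepares for strict positivity, which concerns distinct points and nonzero
  coefficients.\<close>

lemma trig_poly_collect:
  fixes x :: "nat \<Rightarrow> 'a"
  obtains Y C where "finite Y" "\<And>y. y \<in> Y \<Longrightarrow> C y \<noteq> 0"
    "\<And>\<gamma>. trig_poly n x c \<gamma> = (\<Sum>y\<in>Y. C y * \<gamma> y)"
proof -
  define C where "C y = (\<Sum>i | i \<in> {..<n} \<and> x i = y. c i)" for y
  define Y where "Y = {y \<in> x ` {..<n}. C y \<noteq> 0}"
  have "trig_poly n x c \<gamma> = (\<Sum>y\<in>Y. C y * \<gamma> y)" for \<gamma>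
  proof -
    have "trig_poly n x c \<gamma> = (\<Sum>y\<in>x ` {..<n}. \<Sum>i | i \<in> {..<n} \<and> x i = y. c i * \<gamma> (x i))"
      unfolding trig_poly_def by (rule sum.image_gen) simp
    also have "\<dots> = (\<Sum>y\<in>x ` {..<n}. C y * \<gamma> y)"
      unfolding C_def sum_distrib_right by (intro sum.cong) auto
    also have "\<dots> = (\<Sum>y\<in>Y. C y * \<gamma> y)"
      by (rule sum.mono_neutral_right) (auto simp: Y_def)
    finally show ?thesis .
  qed
  moreover have "finite Y" "\<And>y. y \<in> Y \<Longrightarrow> C y \<noteq> 0" by (auto simp: Y_def)
  ultimately show ?thesis by (intro that[of Y C])
qed

section \<open>Transforms of sums of translates, and the two implications\<close>

context compact_abelian_haar
begin

text \<open>Urysohn's lemma: a compact Hausdorff space is normal and finite sets are closed.\<close>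

lemma separating_function:
  assumes "finite S" "a \<notin> S"
  obtains \<phi> :: "'a \<Rightarrow> complex" where "continuous_on UNIV \<phi>" "\<phi> a = 1" "\<And>s. s \<in> S \<Longrightarrow> \<phi> s = 0"
proof -
  have "compact_space (euclidean :: 'a topology)"
    using compact_group by (simp add: compact_space_def)
  moreover have "Hausdorff_space (euclidean :: 'a topology)"
    using hausdorff by (fastforce simp: Hausdorff_space_def disjnt_def)
  ultimately have "normal_space (euclidean :: 'a topology)"
    by (blast intro: compact_Hausdorff_or_regular_imp_normal_space)
  moreover have "closedin euclidean S" "closedin euclidean {a}" "disjnt S {a}"
    using assms by (auto simp: finite_imp_closed simp flip: closed_closedin)
  ultimately obtain \<psi> :: "'a \<Rightarrow> real" where
    \<psi>: "continuous_map euclidean euclideanreal \<psi>" "\<psi> ` S \<subseteq> {0}" "\<psi> ` {a} \<subseteq> {1}"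
    by (rule Urysohn_lemma_alt)
  then have "continuous_on UNIV \<psi>" by simp
  then show ?thesis using that[of "\<lambda>x. complex_of_real (\<psi> x)"] \<psi>
    by (auto simp: continuous_on_of_real image_subset_iff)
qed

text \<open>Convolution with \<open>\<gamma>\<close> commutes with translation; evaluating at 0
  gives the formula.\<close>

lemma fourier_transform_translate:
  assumes f: "continuous_on UNIV f" and \<gamma>: "\<gamma> \<in> dual_group"
  shows "fourier_transform \<mu> (\<lambda>x. f (x + b)) \<gamma> = fourier_transform \<mu> f \<gamma> * \<gamma> b"
proof -
  have "continuous_on UNIV \<gamma>" using \<gamma> by (simp add: dual_group_def)
  from fun_cong[OF conv_translate_left[OF f this, of b], of 0]
  have "fourier_transform \<mu> (\<lambda>x. f (x + b)) \<gamma> * \<gamma> 0 = fourier_transform \<mu> f \<gamma> * \<gamma> b"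
    by (simp add: conv_character[OF \<gamma>])
  moreover have "\<gamma> 0 = 1" using dual_group_add[OF \<gamma>, of 0 0] \<gamma> by (auto simp: dual_group_def) (metis norm_zero zero_neq_one)
  ultimately show ?thesis by simp
qed

lemma continuous_on_sum_translates:
  fixes f :: "'a \<Rightarrow> complex"
  assumes f: "continuous_on UNIV f"
  shows "continuous_on UNIV (\<lambda>x. \<Sum>k\<in>K. d k * f (x + b k))"
  by (intro continuous_on_sum continuous_on_mult continuous_on_const continuous_on_translate f)

lemma fourier_transform_sum_translates:
  assumes f: "continuous_on UNIV f" and \<gamma>: "\<gamma> \<in> dual_group"
  shows "fourier_transform \<mu> (\<lambda>x. \<Sum>k\<in>K. d k * f (x + b k)) \<gamma> =
    fourier_transform \<mu> f \<gamma> * (\<Sum>k\<in>K. d k * \<gamma> (b k))"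
proof -
  have "continuous_on UNIV \<gamma>" using \<gamma> by (simp add: dual_group_def)
  then have int: "integrable \<mu> (\<lambda>x. d k * (f (x + b k) * cnj (\<gamma> x)))" for k
    by (intro integrable_haar_continuous continuous_on_mult continuous_on_const continuous_on_translate
        continuous_on_cnj f)
  have "fourier_transform \<mu> (\<lambda>x. \<Sum>k\<in>K. d k * f (x + b k)) \<gamma> =
      (\<integral>x. (\<Sum>k\<in>K. d k * (f (x + b k) * cnj (\<gamma> x))) \<partial>\<mu>)"
    by (simp add: fourier_transform_def sum_distrib_right mult.assoc)
  also have "\<dots> = (\<Sum>k\<in>K. \<integral>x. d k * (f (x + b k) * cnj (\<gamma> x)) \<partial>\<mu>)"
    by (rule Bochner_Integration.integral_sum[OF int])
  also have "\<dots> = (\<Sum>k\<in>K. d k * fourier_transform \<mu> (\<lambda>x. f (x + b k)) \<gamma>)"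
    by (simp add: fourier_transform_def)
  also have "\<dots> = fourier_transform \<mu> f \<gamma> * (\<Sum>k\<in>K. d k * \<gamma> (b k))"
    by (simp add: fourier_transform_translate[OF f \<gamma>] sum_distrib_left mult_ac)
  finally show ?thesis .
qed

text \<open>A sum of translates indexed by \<open>I \<times> I\<close>, whose character sum factors
  into the polynomial and its conjugate.\<close>

lemma fourier_transform_autocorrelation:
  assumes f: "continuous_on UNIV f" and \<gamma>: "\<gamma> \<in> dual_group"
  shows "fourier_transform \<mu> (\<lambda>x. \<Sum>i\<in>I. \<Sum>j\<in>I. c i * cnj (c j) * f (x + (a i - a j))) \<gamma> =
    fourier_transform \<mu> f \<gamma> * ((\<Sum>i\<in>I. c i * \<gamma> (a i)) * cnj (\<Sum>i\<in>I. c i * \<gamma> (a i)))"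
proof -
  have "\<gamma> (a i - a j) = \<gamma> (a i) * cnj (\<gamma> (a j))" for i j
    using dual_group_add[OF \<gamma>, of "a i" "- a j"] by (simp add: dual_group_uminus[OF \<gamma>])
  then have "(\<Sum>p\<in>I \<times> I. c (fst p) * cnj (c (snd p)) * \<gamma> (a (fst p) - a (snd p))) =
      (\<Sum>i\<in>I. c i * \<gamma> (a i)) * cnj (\<Sum>i\<in>I. c i * \<gamma> (a i))"
    by (simp add: sum_product sum.cartesian_product' mult_ac)
  with fourier_transform_sum_translates[OF f \<gamma>,
      where K = "I \<times> I" and d = "\<lambda>p. c (fst p) * cnj (c (snd p))" and b = "\<lambda>p. a (fst p) - a (snd p)"]
  show ?thesis by (simp add: sum.cartesian_product')
qed

lemma continuous_on_autocorrelation: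
  fixes f :: "'a \<Rightarrow> complex"
  assumes f: "continuous_on UNIV f"
  shows "continuous_on UNIV (\<lambda>x. \<Sum>i\<in>I. \<Sum>j\<in>I. c i * cnj (c j) * f (x + (a i - a j)))"
  by (intro continuous_on_sum continuous_on_mult continuous_on_const continuous_on_translate f)

text \<open>With these coefficients, the sum of translates of any continuous \<open>\<phi>\<close>
  has zero transform and so vanishes. Choosing \<open>\<phi>\<close> to be 1 at \<open>x m\<close>
  and 0 at the other points, its value at 0 is \<open>c m\<close>.\<close>

lemma trig_poly_injective:
  fixes x :: "nat \<Rightarrow> 'a"
  assumes x: "inj_on x {..<n}" and zero: "\<And>\<gamma>. \<gamma> \<in> dual_group \<Longrightarrow> trig_poly n x c \<gamma> = 0"
    and m: "m < n"
  shows "c m = 0"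
proof -
  have "x m \<notin> x ` ({..<n} - {m})" using x m by (auto simp: inj_on_def)
  then obtain \<phi> :: "'a \<Rightarrow> complex" where \<phi>: "continuous_on UNIV \<phi>" "\<phi> (x m) = 1"
      "\<And>s. s \<in> x ` ({..<n} - {m}) \<Longrightarrow> \<phi> s = 0"
    using separating_function[of "x ` ({..<n} - {m})" "x m"] by blast
  have "(\<lambda>y. \<Sum>i<n. c i * \<phi> (y + x i)) = (\<lambda>y. 0)"
  proof (rule fourier_transform_injective[OF continuous_on_sum_translates[OF \<phi>(1)]])
    fix \<gamma> :: "'a \<Rightarrow> complex" assume "\<gamma> \<in> dual_group"
    then show "fourier_transform \<mu> (\<lambda>y. \<Sum>i<n. c i * \<phi> (y + x i)) \<gamma> = 0"
      using zero by (simp add: fourier_transform_sum_translates \<phi> trig_poly_def)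
  qed
  from fun_cong[OF this, of 0] have "(\<Sum>i<n. c i * \<phi> (x i)) = 0" by simp
  moreover have "(\<Sum>i<n. c i * \<phi> (x i)) = (\<Sum>i<n. if i = m then c m else 0)"
    by (intro sum.cong refl) (use \<phi> in auto)
  ultimately show ?thesis using m by simp
qed

text \<open>The autocorrelation has zero transform: on the support the polynomial vanishes, off it
  the transform of \<open>f\<close> does. So the quadratic form is 0, which strictness allows only
  if no points survive collection.\<close>

lemma strictly_positive_definite_imp_spd_subset:
  assumes f: "continuous_on UNIV f" and spd: "strictly_positive_definite f"
  shows "spd_subset (fourier_support \<mu> f)"
  unfolding spd_subset_def
proof (intro allI impI ballI)
  fix n :: nat and x :: "nat \<Rightarrow> 'a" and c :: "nat \<Rightarrow> complex" and \<gamma> :: "'a \<Rightarrow> complex"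
  assume vanish: "\<forall>\<gamma>\<in>fourier_support \<mu> f. trig_poly n x c \<gamma> = 0"
  obtain Y C where Y: "finite Y" "\<And>y. y \<in> Y \<Longrightarrow> C y \<noteq> 0"
      "\<And>\<gamma>. trig_poly n x c \<gamma> = (\<Sum>y\<in>Y. C y * \<gamma> y)"
    using trig_poly_collect[of n x c] by blast
  have "(\<lambda>x. \<Sum>y\<in>Y. \<Sum>z\<in>Y. C y * cnj (C z) * f (x + (y - z))) = (\<lambda>x. 0)"
  proof (rule fourier_transform_injective[OF continuous_on_autocorrelation[OF f]])
    fix \<gamma> :: "'a \<Rightarrow> complex" assume \<gamma>: "\<gamma> \<in> dual_group"
    show "fourier_transform \<mu> (\<lambda>x. \<Sum>y\<in>Y. \<Sum>z\<in>Y. C y * cnj (C z) * f (x + (y - z))) \<gamma> = 0"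
      using vanish \<gamma> Y(3)[of \<gamma>] fourier_transform_autocorrelation[OF f \<gamma>, of C "\<lambda>y. y" Y]
      by (cases "fourier_transform \<mu> f \<gamma> = 0") (auto simp: fourier_support_def)
  qed
  from fun_cong[OF this, of 0] have "(\<Sum>y\<in>Y. \<Sum>z\<in>Y. C y * cnj (C z) * f (y - z)) = 0" by simp
  then have "Y = {}" using strictly_positive_definite_sum_pos[OF spd Y(1) _ Y(2)] by fastforce
  then show "trig_poly n x c \<gamma> = 0" by (simp add: Y(3))
qed

text \<open>A zero of the quadratic form makes the autocorrelation vanish identically, so the
  polynomial vanishes on the support. By \<open>K\<close> it vanishes on all characters, and
  independence of evaluations contradicts the nonzero coefficients.\<close>

lemma spd_subset_imp_strictly_positive_definite:
  assumes f: "continuous_on UNIV f" and pd: "positive_definite f"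
    and K: "spd_subset (fourier_support \<mu> f)"
  shows "strictly_positive_definite f"
  unfolding strictly_positive_definite_def
proof (intro conjI pd allI impI)
  fix n :: nat and x :: "nat \<Rightarrow> 'a" and c :: "nat \<Rightarrow> complex"
  assume n: "n \<ge> 1" and c: "\<forall>i<n. c i \<noteq> 0" and x: "inj_on x {..<n}"
  let ?s = "\<Sum>i<n. \<Sum>j<n. c i * cnj (c j) * f (x i - x j)"
  have "?s \<noteq> 0"
  proof
    assume "?s = 0"
    from positive_definite_autocorrelation_eq_0[OF pd finite_lessThan this]
    have g: "(\<lambda>y. \<Sum>i<n. \<Sum>j<n. c i * cnj (c j) * f (y + (x i - x j))) = (\<lambda>y. 0)" by blast
    have "trig_poly n x c \<gamma> = 0" if "\<gamma> \<in> fourier_support \<mu> f" for \<gamma>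
    proof -
      have \<gamma>: "\<gamma> \<in> dual_group" "fourier_transform \<mu> f \<gamma> \<noteq> 0"
        using that by (auto simp: fourier_support_def)
      have "fourier_transform \<mu> (\<lambda>y. 0) \<gamma> = 0" by (simp add: fourier_transform_def)
      then show ?thesis
        using fourier_transform_autocorrelation[OF f \<gamma>(1), of c x "{..<n}"] \<gamma>(2)
        unfolding g trig_poly_def by (simp del: cnj_sum)
    qed
    then have "trig_poly n x c \<gamma> = 0" if "\<gamma> \<in> dual_group" for \<gamma>
      using K[unfolded spd_subset_def, rule_format, of n x c \<gamma>] that by simp
    from trig_poly_injective[OF x this, of 0] show False using n c by auto
  qed
  moreover have "?s \<ge> 0" by (rule positive_definite_sum_nonneg[OF pd]) simp
  ultimately show "?s > 0" by (simp only: less_le) simp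
qed

end

theorem theorem2p2:
  fixes f :: "'a::{ab_group_add,t2_space} \<Rightarrow> complex" and \<mu> :: "'a measure"
  assumes "compact_abelian_group TYPE('a)"
    and "haar_measure \<mu>"
    and "continuous_on UNIV f"
    and "positive_definite f"
  shows "strictly_positive_definite f \<longleftrightarrow> spd_subset (fourier_support \<mu> f)"
proof -
  interpret compact_abelian_haar \<mu>
    using assms(1,2) by unfold_locales
  show ?thesis
    using strictly_positive_definite_imp_spd_subset[OF assms(3)]
      spd_subset_imp_strictly_positive_definite[OF assms(3,4)]
    by (rule iffI)
qed

end
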